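(* Let $\mathbf{A}\in\mathbb{R}^{m\times n}$, $\boldsymbol{b}\in\mathbb{R}^m$, and let $\mathbf{W}\in\mathbb{R}^{n\times n}$ be symmetric with spectrum $\sigma(\mathbf{W})\subset[0,1]$. For $\lambda>0$ consider the function $f:\mathbb{R}^n\to(-\infty,\infty]$ given by $$f(\boldsymbol{x})=\ell_{\mathbf{A}}(\boldsymbol{x})+\lambda\,\varphi_{\mathbf{W}}(\boldsymbol{x}),$$ where $$\ell_{\mathbf{A}}(\boldsymbol{x})=\tfrac12\|\mathbf{A}\boldsymbol{x}-\boldsymbol{b}\|_2^2,\qquad \varphi_{\mathbf{W}}(\boldsymbol{x})=\tfrac12\boldsymbol{x}^\top\mathbf{W}^{\dagger}(\mathbf{I}-\mathbf{W})\boldsymbol{x}+\iota_{\mathcal{R}(\mathbf{W})}(\boldsymbol{x}).$$ Then, for any $\lambda>0$, $f$ is strongly convex on $(\mathbb{R}^n,\langle\cdot,\cdot\rangle_2)$ if and only if $\mathcal{N}(\mathbf{A})\cap\mathrm{fix}(\mathbf{W})=\{\mathbf{0}\}$. Moreover, if $$\mathbf{Q}:=\mathbf{A}^\top\mathbf{A}+\lambda\mathbf{W}^{\dagger}(\mathbf{I}-\mathbf{W}),$$ then the strong convexity index of $f$ is $$\mu=\inf\{\boldsymbol{v}^\top\mathbf{Q}\boldsymbol{v}:\ \boldsymbol{v}\in\mathcal{R}(\mathbf{W})\cap\mathcal{S}_n\}.$$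
   Context: $\langle\boldsymbol{x},\boldsymbol{y}\rangle_2=\boldsymbol{x}^\top\boldsymbol{y}$ is the standard inner product on $\mathbb{R}^n$, with norm $\|\cdot\|_2$. $\mathcal{S}_n$ is the unit sphere of $\mathbb{R}^n$. $\mathcal{N}(\cdot)$ and $\mathcal{R}(\cdot)$ denote null space and range; $\mathrm{fix}(\mathbf{W})=\{\boldsymbol{x}:\mathbf{W}\boldsymbol{x}=\boldsymbol{x}\}$; $\mathbf{W}^\dagger$ is the Moore–Penrose pseudoinverse. For a nonempty convex set $\Omega$, $\iota_\Omega(\boldsymbol{x})=0$ if $\boldsymbol{x}\in\Omega$ and $+\infty$ otherwise. A proper, closed, convex function $f:\mathbb{R}^n\to(-\infty,\infty]$ is strongly convex on a Euclidean space $(\mathbb{R}^n,\langle\cdot,\cdot\rangle)$ with induced norm $\|\cdot\|$ if there exists $\mu>0$ such that for all $\boldsymbol{x},\boldsymbol{y}\in\mathbb{R}^n$ and $\theta\in[0,1]$, $$f(\theta\boldsymbol{x}+(1-\theta)\boldsymbol{y})\le\theta f(\boldsymbol{x})+(1-\theta)f(\boldsymbol{y})-\tfrac{\mu}{2}\theta(1-\theta)\|\boldsymbol{x}-\boldsymbol{y}\|^2.$$ The largest $\mu$ in this inequality is the strong convexity index of $f$. *)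

theory Defs
  imports "HOL-Analysis.Analysis"
begin

section \<open>Matrices\<close>

definition null_space :: "real^'n^'m \<Rightarrow> (real^'n) set" where
  "null_space A = {x. A *v x = 0}"

definition range_space :: "real^'n^'m \<Rightarrow> (real^'m) set" where
  "range_space A = range (\<lambda>x. A *v x)"

definition fix_space :: "real^'n^'n \<Rightarrow> (real^'n) set" where
  "fix_space W = {x. W *v x = x}"

text \<open>Real eigenvalues only; for the symmetric matrices considered here this is the
  whole (complex) spectrum.\<close>

definition spectrum :: "real^'n^'n \<Rightarrow> real set" where
  "spectrum W = {k. \<exists>v. v \<noteq> 0 \<and> W *v v = k *\<^sub>R v}"

text \<open>The four Penrose conditions, which determine \<open>X\<close> uniquely.\<close>

definition is_pseudoinverse :: "real^'n^'m \<Rightarrow> real^'m^'n \<Rightarrow> bool" where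
  "is_pseudoinverse A X \<longleftrightarrow>
     A ** X ** A = A \<and> X ** A ** X = X \<and>
     transpose (A ** X) = A ** X \<and> transpose (X ** A) = X ** A"

definition pseudoinverse :: "real^'n^'m \<Rightarrow> real^'m^'n" where
  "pseudoinverse A = (THE X. is_pseudoinverse A X)"

section \<open>Extended-real-valued convex functions\<close>

text \<open>The library's \<open>epigraph\<close> is for real-valued functions only.\<close>

definition ereal_epigraph :: "('a \<Rightarrow> ereal) \<Rightarrow> ('a \<times> real) set" where
  "ereal_epigraph f = {(x, r). f x \<le> ereal r}"

definition proper_fun :: "('a \<Rightarrow> ereal) \<Rightarrow> bool" where
  "proper_fun f \<longleftrightarrow> (\<forall>x. f x \<noteq> -\<infinity>) \<and> (\<exists>x. f x \<noteq> \<infinity>)"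

definition closed_fun :: "('a::euclidean_space \<Rightarrow> ereal) \<Rightarrow> bool" where
  "closed_fun f \<longleftrightarrow> closed (ereal_epigraph f)"

definition convex_fun :: "('a::euclidean_space \<Rightarrow> ereal) \<Rightarrow> bool" where
  "convex_fun f \<longleftrightarrow> convex (ereal_epigraph f)"

definition strong_convexity_ineq :: "('a::euclidean_space \<Rightarrow> ereal) \<Rightarrow> real \<Rightarrow> bool" where
  "strong_convexity_ineq f \<mu> \<longleftrightarrow>
     (\<forall>x y. \<forall>\<theta>\<in>{0..1}.
        f (\<theta> *\<^sub>R x + (1 - \<theta>) *\<^sub>R y)
          \<le> ereal \<theta> * f x + ereal (1 - \<theta>) * f y
             - ereal (\<mu> / 2 * \<theta> * (1 - \<theta>) * (norm (x - y))\<^sup>2))"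

definition strongly_convex :: "('a::euclidean_space \<Rightarrow> ereal) \<Rightarrow> bool" where
  "strongly_convex f \<longleftrightarrow>
     proper_fun f \<and> closed_fun f \<and> convex_fun f \<and> (\<exists>\<mu>>0. strong_convexity_ineq f \<mu>)"

text \<open>The index is the largest \<open>\<mu>\<close> satisfying the inequality. If every \<open>\<mu>\<close> does, which for
  a proper \<open>f\<close> means that \<open>f\<close> is finite at a single point only, there is no largest one and the
  index is \<open>\<infinity>\<close>. The maximum is over all real \<open>\<mu>\<close>: for strongly convex \<open>f\<close> it is the same as
  the one over positive \<open>\<mu>\<close>, and a convex \<open>f\<close> that is not strongly convex has index \<open>0\<close>.\<close>

definition is_strong_convexity_index :: "('a::euclidean_space \<Rightarrow> ereal) \<Rightarrow> ereal \<Rightarrow> bool" where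
  "is_strong_convexity_index f m \<longleftrightarrow>
     (\<exists>r. m = ereal r \<and> strong_convexity_ineq f r \<and>
          (\<forall>\<mu>. strong_convexity_ineq f \<mu> \<longrightarrow> \<mu> \<le> r)) \<or>
     (m = \<infinity> \<and> (\<forall>\<mu>. strong_convexity_ineq f \<mu>))"

section \<open>The objective\<close>

definition convex_indicator :: "'a set \<Rightarrow> 'a \<Rightarrow> ereal" where
  "convex_indicator S x = (if x \<in> S then 0 else \<infinity>)"

definition loss :: "real^'n^'m \<Rightarrow> real^'m \<Rightarrow> real^'n \<Rightarrow> real" where
  "loss A b x = 1/2 * (norm (A *v x - b))\<^sup>2"

definition regularizer :: "real^'n^'n \<Rightarrow> real^'n \<Rightarrow> ereal" where
  "regularizer W x =
     ereal (1/2 * (x \<bullet> ((pseudoinverse W ** (mat 1 - W)) *v x)))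
     + convex_indicator (range_space W) x"

definition objective ::
  "real^'n^'m \<Rightarrow> real^'m \<Rightarrow> real^'n^'n \<Rightarrow> real \<Rightarrow> real^'n \<Rightarrow> ereal" where
  "objective A b W lam x = ereal (loss A b x) + ereal lam * regularizer W x"

end

theory Submission
  imports Defs
begin

text \<open>On \<open>R(W)\<close> the objective is a quadratic function with Hessian \<open>Q\<close>, and for a quadratic
  function the convexity gap at \<open>x, y, \<theta>\<close> is exactly \<open>\<theta>(1 - \<theta>)/2\<close> times
  \<open>(x - y)\<^sup>\<top>Q(x - y)\<close>. So \<open>\<mu>\<close> is admissible iff it is a lower bound of \<open>v\<^sup>\<top>Qv\<close> on the unit
  sphere of \<open>R(W)\<close>, where by compactness the infimum is attained. Writing \<open>y = W\<^sup>\<dagger>v\<close>, one has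
  \<open>v\<^sup>\<top>W\<^sup>\<dagger>(I - W)v = y\<^sup>\<top>(W - W\<^sup>2)y\<close>, and \<open>W - W\<^sup>2\<close> is positive semidefinite because
  \<open>\<sigma>(W) \<subseteq> [0,1]\<close>; hence \<open>v\<^sup>\<top>Qv = 0\<close> exactly for \<open>v \<in> N(A) \<inter> fix(W)\<close>.\<close>

section \<open>Symmetric matrices\<close>

lemma inner_matrix_vector_mult:
  fixes A :: "real^'n^'m"
  shows "x \<bullet> (A *v y) = (transpose A *v x) \<bullet> y"
  by (simp add: dot_lmul_matrix transpose_matrix_vector)

text \<open>Moving from \<open>v\<close> in the direction \<open>- (S *v v)\<close> would make the
  form negative to first order unless \<open>S *v v\<close> vanishes. Symmetry of \<open>S\<close>
  makes the two cross terms equal.\<close>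

lemma symmetric_psd_eq_0:
  fixes S :: "real^'n^'n"
  assumes sym: "transpose S = S" and psd: "\<And>v. 0 \<le> v \<bullet> (S *v v)"
    and "v \<bullet> (S *v v) = 0"
  shows "S *v v = 0"
proof -
  define u where "u = S *v v"
  define q where "q = u \<bullet> (S *v u)"
  have vu: "v \<bullet> (S *v u) = u \<bullet> u"
    using inner_matrix_vector_mult[of v S u] sym by (simp add: u_def)
  have "0 \<le> - 2 * t * (u \<bullet> u) + t^2 * q" for t
  proof -
    have "(v - t *\<^sub>R u) \<bullet> (S *v (v - t *\<^sub>R u)) = - 2 * t * (u \<bullet> u) + t^2 * q"
      using assms(3) vu
      by (simp add: matrix_vector_mult_diff_distrib matrix_vector_mult_scaleR inner_diff_left
          inner_diff_right q_def algebra_simps power2_eq_square flip: u_def)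
    then show ?thesis using psd[of "v - t *\<^sub>R u"] by (simp only:)
  qed
  \<comment> \<open>The minimizer of the quadratic in \<open>t\<close> is
    \<open>(u \<bullet> u) / q\<close>; taking \<open>1 + q\<close> instead keeps the denominator
    positive when \<open>q = 0\<close>, and the linear term still dominates.\<close>
  from this[of "(u \<bullet> u) / (1 + q)"]
  have h: "0 \<le> - 2 * ((u \<bullet> u)^2 / (1 + q)) + (u \<bullet> u)^2 / (1 + q)^2 * q"
    by (simp add: power_divide power2_eq_square)
  have q0: "0 \<le> q" using psd by (simp add: q_def)
  have "(u \<bullet> u)^2 / (1 + q)^2 * q \<le> (u \<bullet> u)^2 / (1 + q)"
  proof -
    have "(u \<bullet> u)^2 / (1 + q)^2 * q = (u \<bullet> u)^2 / (1 + q) * (q / (1 + q))"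
      by (simp add: power2_eq_square)
    also have "\<dots> \<le> (u \<bullet> u)^2 / (1 + q) * 1"
      using q0 by (intro mult_left_mono) simp_all
    finally show ?thesis by simp
  qed
  with h have "(u \<bullet> u)^2 / (1 + q) \<le> 0" by linarith
  then have "u \<bullet> u = 0" using q0 by (simp add: divide_le_0_iff)
  then show ?thesis by (simp add: u_def)
qed

text \<open>The minimum \<open>k\<close> of the form on the unit sphere exists by compactness. Then
  \<open>S - k I\<close> is positive semidefinite and its form vanishes at the minimizer, so
  \<open>symmetric_psd_eq_0\<close> turns the minimizer into an eigenvector.\<close>

lemma symmetric_min_eigenvalue:
  fixes S :: "real^'n^'n"
  assumes sym: "transpose S = S"
  obtains v k where "v \<noteq> 0" "S *v v = k *\<^sub>R v" "\<And>x. k * (x \<bullet> x) \<le> x \<bullet> (S *v x)"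
proof -
  have "\<exists>v\<in>sphere 0 1. \<forall>x\<in>sphere 0 1. v \<bullet> (S *v v) \<le> x \<bullet> (S *v x)"
    by (intro continuous_attains_inf continuous_intros compact_sphere) simp
  then obtain v where v: "v \<in> sphere 0 1"
    and min: "\<And>x. x \<in> sphere 0 1 \<Longrightarrow> v \<bullet> (S *v v) \<le> x \<bullet> (S *v x)"
    by blast
  define k where "k = v \<bullet> (S *v v)"
  have ge: "k * (x \<bullet> x) \<le> x \<bullet> (S *v x)" for x
  proof (cases "x = 0")
    case False
    have "k \<le> (x /\<^sub>R norm x) \<bullet> (S *v (x /\<^sub>R norm x))"
      unfolding k_def using False by (intro min) simp
    also have "\<dots> = (x \<bullet> (S *v x)) / (x \<bullet> x)"
      by (simp add: matrix_vector_mult_scaleR divide_inverse dot_square_norm power2_eq_square)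
    finally show ?thesis using False by (simp add: field_simps)
  qed simp
  define T where "T = S - k *\<^sub>R mat 1"
  have T: "T *v x = S *v x - k *\<^sub>R x" for x
    by (simp add: T_def matrix_vector_mult_diff_rdistrib scaleR_matrix_vector_assoc[symmetric])
  have "transpose T = T"
    using sym by (simp add: T_def transpose_def vec_eq_iff mat_def)
  moreover have "0 \<le> x \<bullet> (T *v x)" for x
    using ge by (simp add: T inner_diff_right)
  moreover have "v \<bullet> (T *v v) = 0"
    using v by (simp add: T inner_diff_right k_def dot_square_norm)
  ultimately have "T *v v = 0" by (rule symmetric_psd_eq_0)
  moreover have "v \<noteq> 0" using v by auto
  ultimately show ?thesis using ge that[of v k] by (simp add: T)
qed

text \<open>A negative eigenvalue \<open>k\<close> of \<open>W - W\<^sup>2\<close> would make a root of \<open>t\<^sup>2 - t + k\<close> an eigenvalue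
  of \<open>W\<close>; but both roots lie outside \<open>[0,1]\<close>, since their sum is \<open>1\<close> and their product is \<open>k\<close>.\<close>

lemma spectrum_unit_interval_psd:
  fixes W :: "real^'n^'n"
  assumes sym: "transpose W = W" and spec: "spectrum W \<subseteq> {0..1}"
  shows "0 \<le> x \<bullet> ((W - W ** W) *v x)"
proof -
  have "transpose (W - W ** W) = W - W ** W"
    using sym matrix_transpose_mul[of W W] by (simp add: transpose_def vec_eq_iff)
  then obtain v k where v: "v \<noteq> 0" "(W - W ** W) *v v = k *\<^sub>R v"
    and ge: "\<And>x. k * (x \<bullet> x) \<le> x \<bullet> ((W - W ** W) *v x)"
    by (rule symmetric_min_eigenvalue) blast
  have "0 \<le> k"
  proof (rule ccontr)
    assume "\<not> 0 \<le> k"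
    then have k: "k < 0" by simp
    define a where "a = (1 - sqrt (1 - 4 * k)) / 2"
    define c where "c = (1 + sqrt (1 - 4 * k)) / 2"
    have "1 < sqrt (1 - 4 * k)" using k by simp
    then have a: "a < 0" and c: "1 < c" by (simp_all add: a_def c_def)
    have sum: "a + c = 1" by (simp add: a_def c_def field_simps)
    have prod: "a * c = k"
    proof -
      have "4 * (a * c) = 1 - (sqrt (1 - 4 * k))^2"
        by (simp add: a_def c_def field_simps power2_eq_square del: real_sqrt_pow2_iff)
      then show ?thesis using k by simp
    qed
    have WW: "W *v (W *v v) = W *v v - k *\<^sub>R v"
    proof -
      have "W *v v - W *v (W *v v) = k *\<^sub>R v"
        using v(2) by (simp add: matrix_vector_mult_diff_rdistrib flip: matrix_vector_mul_assoc)
      then show ?thesis by (simp add: algebra_simps)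
    qed
    \<comment> \<open>Since \<open>a\<close> and \<open>c\<close> are the roots of
      \<open>t\<^sup>2 - t + k\<close>, the product \<open>(W - a I)(W - c I)\<close> annihilates
      \<open>v\<close>. So \<open>u = (W - c I) v\<close> is an eigenvector for \<open>a\<close>,
      unless it is zero and \<open>v\<close> itself is one for \<open>c\<close>.\<close>
    define u where "u = W *v v - c *\<^sub>R v"
    have "W *v u = W *v v - (a * c) *\<^sub>R v - c *\<^sub>R (W *v v)"
      by (simp add: u_def matrix_vector_mult_diff_distrib matrix_vector_mult_scaleR WW prod)
    also have "\<dots> = (a + c) *\<^sub>R (W *v v) - (a * c) *\<^sub>R v - c *\<^sub>R (W *v v)"
      by (simp add: sum)
    also have "\<dots> = a *\<^sub>R u"
      by (simp add: u_def algebra_simps)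
    finally have "W *v u = a *\<^sub>R u" .
    then have "u = 0 \<or> a \<in> spectrum W" by (auto simp: spectrum_def)
    moreover have "u = 0 \<Longrightarrow> c \<in> spectrum W"
      using v(1) by (auto simp: spectrum_def u_def)
    ultimately show False using a c spec by (auto simp: subset_iff)
  qed
  then have "0 \<le> k * (x \<bullet> x)" by simp
  then show ?thesis using ge order_trans by blast
qed

section \<open>The pseudoinverse of a symmetric matrix\<close>

text \<open>\<open>A ** X\<close> and \<open>A ** Y\<close> are symmetric and each absorbs the
  other, so transposing their product identifies them; likewise \<open>X ** A\<close> and
  \<open>Y ** A\<close>. Then \<open>X = XAX = YAX = YAY = Y\<close>.\<close>

lemma is_pseudoinverse_unique:
  assumes X: "is_pseudoinverse A X" and Y: "is_pseudoinverse A Y"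
  shows "X = Y"
proof -
  have X1: "A ** X ** A = A" and X2: "X ** A ** X = X"
    and X3: "transpose (A ** X) = A ** X" and X4: "transpose (X ** A) = X ** A"
    using X by (simp_all add: is_pseudoinverse_def)
  have Y1: "A ** Y ** A = A" and Y2: "Y ** A ** Y = Y"
    and Y3: "transpose (A ** Y) = A ** Y" and Y4: "transpose (Y ** A) = Y ** A"
    using Y by (simp_all add: is_pseudoinverse_def)
  have "A ** X = (A ** Y) ** (A ** X)"
    by (simp add: matrix_mul_assoc Y1)
  also have "\<dots> = transpose ((A ** X) ** (A ** Y))"
    by (simp only: matrix_transpose_mul[of "A ** X"] X3 Y3)
  also have "\<dots> = A ** Y"
    by (simp add: matrix_mul_assoc X1 Y3)
  finally have AX: "A ** X = A ** Y" .
  have "X ** A = (X ** A) ** (Y ** A)"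
    using Y1 by (simp only: matrix_mul_assoc[symmetric])
  also have "\<dots> = transpose ((Y ** A) ** (X ** A))"
    by (simp only: matrix_transpose_mul[of "Y ** A"] X4 Y4)
  also have "(Y ** A) ** (X ** A) = Y ** A"
    using X1 by (simp only: matrix_mul_assoc[symmetric])
  finally have XA: "X ** A = Y ** A"
    by (simp only: Y4)
  have "X = Y ** (A ** X)"
    using X2 by (simp only: XA matrix_mul_assoc)
  also have "\<dots> = Y"
    using Y2 by (simp only: AX matrix_mul_assoc)
  finally show ?thesis .
qed

text \<open>A symmetric \<open>W\<close> is injective on its range, so \<open>G W\<^sup>2 = W\<close> for some \<open>G\<close>. Then \<open>G W\<close> is the
  orthogonal projection onto the range, and \<open>G W G\<^sup>\<top>\<close> is the pseudoinverse.\<close>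

lemma symmetric_has_pseudoinverse:
  fixes W :: "real^'n^'n"
  assumes sym: "transpose W = W"
  obtains X where "is_pseudoinverse W X" "transpose X = X"
proof -
  have inj: "inj_on ((*v) W) (range ((*v) W))"
  proof (rule inj_onI)
    fix x y assume xy: "x \<in> range ((*v) W)" "y \<in> range ((*v) W)" "W *v x = W *v y"
    then obtain z where z: "x - y = W *v z"
      by (auto simp flip: matrix_vector_mult_diff_distrib)
    \<comment> \<open>The difference lies in both the range and the kernel of \<open>W\<close>,
      which are orthogonal by symmetry.\<close>
    have "(x - y) \<bullet> (x - y) = (W *v (x - y)) \<bullet> z"
      using inner_matrix_vector_mult[of "x - y" W z] sym z by simp
    also have "\<dots> = 0" using xy by (simp add: matrix_vector_mult_diff_distrib)
    finally show "x = y" by simp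
  qed
  have "subspace (range ((*v) W))"
    by (rule linear_subspace_image[OF matrix_vector_mul_linear subspace_UNIV])
  then obtain g where g: "linear g" "\<And>v. v \<in> range ((*v) W) \<Longrightarrow> g (W *v v) = v"
    using linear_exists_left_inverse_on[OF matrix_vector_mul_linear _ inj] by blast
  define G where "G = matrix g"
  have "(G ** W ** W) *v x = W *v x" for x
    using g by (simp add: G_def matrix_works flip: matrix_vector_mul_assoc)
  then have GWW: "G ** W ** W = W" by (simp add: matrix_eq)
  from arg_cong[OF this, of transpose] have WWG: "W ** W ** transpose G = W"
    by (simp add: matrix_transpose_mul sym matrix_mul_assoc)
  \<comment> \<open>Evaluating \<open>G W W G\<^sup>\<top>\<close> in two ways shows that
    \<open>G ** W\<close> equals its own transpose.\<close>
  have "G ** W = G ** (W ** W ** transpose G)" by (simp only: WWG)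
  also have "\<dots> = (G ** W ** W) ** transpose G" by (simp only: matrix_mul_assoc)
  finally have GW: "G ** W = W ** transpose G" by (simp only: GWW)
  have "W ** G ** W = W ** (G ** W)" by (simp only: matrix_mul_assoc)
  also have "\<dots> = W" by (simp only: GW matrix_mul_assoc WWG)
  finally have WGW: "W ** G ** W = W" .
  define X where "X = G ** W ** transpose G"
  have "X ** W = G ** (W ** transpose G) ** W" by (simp only: X_def matrix_mul_assoc)
  also have "\<dots> = G ** (G ** W ** W)" by (simp only: GW[symmetric] matrix_mul_assoc)
  finally have XW: "X ** W = G ** W" by (simp only: GWW)
  have "W ** X = (W ** G ** W) ** transpose G" by (simp only: X_def matrix_mul_assoc)
  then have WX: "W ** X = G ** W" by (simp only: WGW GW)
  have tGW: "transpose (G ** W) = G ** W"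
    by (simp only: matrix_transpose_mul sym GW[symmetric])
  have "X ** W ** X = G ** (W ** G ** W) ** transpose G"
    unfolding XW by (simp only: X_def matrix_mul_assoc)
  then have "X ** W ** X = X" by (simp only: WGW X_def)
  then have "is_pseudoinverse W X"
    using tGW GWW by (simp add: is_pseudoinverse_def XW WX)
  moreover have "transpose X = X"
    by (simp add: X_def matrix_transpose_mul sym matrix_mul_assoc)
  ultimately show ?thesis by (rule that)
qed

lemma pseudoinverse_symmetric:
  fixes W :: "real^'n^'n"
  assumes sym: "transpose W = W"
  shows "is_pseudoinverse W (pseudoinverse W)" "transpose (pseudoinverse W) = pseudoinverse W"
proof -
  obtain X where X: "is_pseudoinverse W X" "transpose X = X"
    using symmetric_has_pseudoinverse[OF sym] .
  then have "pseudoinverse W = X"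
    unfolding pseudoinverse_def using is_pseudoinverse_unique by blast
  with X show "is_pseudoinverse W (pseudoinverse W)"
    "transpose (pseudoinverse W) = pseudoinverse W" by simp_all
qed

lemma mult_pseudoinverse_range:
  fixes W :: "real^'n^'n"
  assumes sym: "transpose W = W" and v: "v \<in> range_space W"
  shows "W *v (pseudoinverse W *v v) = v"
proof -
  obtain z where "v = W *v z" using v by (auto simp: range_space_def)
  moreover have "(W ** pseudoinverse W ** W) *v z = W *v z"
    using pseudoinverse_symmetric(1)[OF sym] by (simp add: is_pseudoinverse_def)
  ultimately show ?thesis by (simp flip: matrix_vector_mul_assoc)
qed

lemma regularizer_form_range:
  fixes W :: "real^'n^'n"
  assumes sym: "transpose W = W" and v: "v \<in> range_space W"
  defines "y \<equiv> pseudoinverse W *v v"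
  shows "v \<bullet> ((pseudoinverse W ** (mat 1 - W)) *v v) = y \<bullet> ((W - W ** W) *v y)"
proof -
  have vy: "W *v y = v" using mult_pseudoinverse_range[OF sym v] by (simp add: y_def)
  have "v \<bullet> ((pseudoinverse W ** (mat 1 - W)) *v v) = y \<bullet> (v - W *v v)"
    using inner_matrix_vector_mult[of v "pseudoinverse W" "v - W *v v"]
      pseudoinverse_symmetric(2)[OF sym]
    by (simp add: y_def matrix_vector_mult_diff_rdistrib flip: matrix_vector_mul_assoc)
  also have "\<dots> = y \<bullet> ((W - W ** W) *v y)"
    by (simp add: matrix_vector_mult_diff_rdistrib vy flip: matrix_vector_mul_assoc)
  finally show ?thesis .
qed

lemma regularizer_form_nonneg:
  fixes W :: "real^'n^'n"
  assumes "transpose W = W" "spectrum W \<subseteq> {0..1}" "v \<in> range_space W"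
  shows "0 \<le> v \<bullet> ((pseudoinverse W ** (mat 1 - W)) *v v)"
  using spectrum_unit_interval_psd assms by (simp add: regularizer_form_range)

text \<open>With \<open>v = W y\<close>, a vanishing form puts \<open>y\<close> in the kernel of the
  positive semidefinite matrix \<open>W - W ** W\<close>, which says \<open>W v = v\<close>.
  Conversely, \<open>I - W\<close> already annihilates a fixed vector.\<close>

lemma regularizer_form_eq_0_iff:
  fixes W :: "real^'n^'n"
  assumes sym: "transpose W = W" and spec: "spectrum W \<subseteq> {0..1}" and v: "v \<in> range_space W"
  shows "v \<bullet> ((pseudoinverse W ** (mat 1 - W)) *v v) = 0 \<longleftrightarrow> v \<in> fix_space W"
proof
  define y where "y = pseudoinverse W *v v"
  assume "v \<bullet> ((pseudoinverse W ** (mat 1 - W)) *v v) = 0"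
  then have "y \<bullet> ((W - W ** W) *v y) = 0"
    using regularizer_form_range[OF sym v] by (simp add: y_def)
  moreover have "transpose (W - W ** W) = W - W ** W"
    using sym matrix_transpose_mul[of W W] by (simp add: transpose_def vec_eq_iff)
  ultimately have "(W - W ** W) *v y = 0"
    using spectrum_unit_interval_psd[OF sym spec] symmetric_psd_eq_0 by blast
  then show "v \<in> fix_space W"
    using mult_pseudoinverse_range[OF sym v]
    by (simp add: fix_space_def y_def matrix_vector_mult_diff_rdistrib flip: matrix_vector_mul_assoc)
next
  assume "v \<in> fix_space W"
  then show "v \<bullet> ((pseudoinverse W ** (mat 1 - W)) *v v) = 0"
    by (simp add: fix_space_def matrix_vector_mult_diff_rdistrib flip: matrix_vector_mul_assoc)
qed

section \<open>Quadratic functions on a subspace\<close>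

definition quadratic :: "real^'n^'n \<Rightarrow> real^'n \<Rightarrow> real \<Rightarrow> real^'n \<Rightarrow> real" where
  "quadratic Q c d x = 1/2 * (x \<bullet> (Q *v x)) + c \<bullet> x + d"

text \<open>This is the common shape of the objective: a quadratic function plus the indicator of
  \<open>S\<close>, later taken to be the range of \<open>W\<close>.\<close>

definition quadratic_on :: "(real^'n) set \<Rightarrow> real^'n^'n \<Rightarrow> real^'n \<Rightarrow> real \<Rightarrow> real^'n \<Rightarrow> ereal" where
  "quadratic_on S Q c d x = (if x \<in> S then ereal (quadratic Q c d x) else \<infinity>)"

lemma quadratic_form_convex_comb:
  fixes Q :: "real^'n^'n" and t :: real
  shows "(t *\<^sub>R x + (1 - t) *\<^sub>R y) \<bullet> (Q *v (t *\<^sub>R x + (1 - t) *\<^sub>R y)) =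
    t * (x \<bullet> (Q *v x)) + (1 - t) * (y \<bullet> (Q *v y)) - t * (1 - t) * ((x - y) \<bullet> (Q *v (x - y)))"
proof -
  \<comment> \<open>\<open>Q\<close> is an arbitrary matrix here, so the cross terms
    \<open>q\<close> and \<open>r\<close> may differ.\<close>
  define p q r s where "p = x \<bullet> (Q *v x)" and "q = x \<bullet> (Q *v y)"
    and "r = y \<bullet> (Q *v x)" and "s = y \<bullet> (Q *v y)"
  have comb: "(t *\<^sub>R x + (1 - t) *\<^sub>R y) \<bullet> (Q *v (t *\<^sub>R x + (1 - t) *\<^sub>R y)) =
      t * (t * p + (1 - t) * r) + (1 - t) * (t * q + (1 - t) * s)"
    by (simp only: matrix_vector_right_distrib matrix_vector_mult_scaleR inner_add_left
        inner_add_right inner_scaleR_left inner_scaleR_right p_def q_def r_def s_def distrib_left)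
  have diff: "(x - y) \<bullet> (Q *v (x - y)) = p - q - r + s"
    by (simp add: matrix_vector_mult_diff_distrib inner_diff_left inner_diff_right
        p_def q_def r_def s_def)
  show ?thesis
    unfolding comb diff p_def[symmetric] s_def[symmetric] by (simp add: algebra_simps)
qed

lemma quadratic_convex_comb:
  fixes Q :: "real^'n^'n" and t :: real
  shows "quadratic Q c d (t *\<^sub>R x + (1 - t) *\<^sub>R y) =
    t * quadratic Q c d x + (1 - t) * quadratic Q c d y
    - (t * (1 - t)) * ((x - y) \<bullet> (Q *v (x - y))) / 2"
proof -
  define D where "D = (x - y) \<bullet> (Q *v (x - y))"
  show ?thesis
    unfolding quadratic_def quadratic_form_convex_comb D_def[symmetric]
      inner_add_right inner_scaleR_right
    by (simp add: field_simps)
qed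

lemma strong_convexity_ineq_quadratic_on_iff:
  fixes S :: "(real^'n) set"
  assumes S: "subspace S"
  shows "strong_convexity_ineq (quadratic_on S Q c d) \<mu> \<longleftrightarrow>
    (\<forall>v\<in>S. \<mu> * (v \<bullet> v) \<le> v \<bullet> (Q *v v))"
proof
  assume L: "strong_convexity_ineq (quadratic_on S Q c d) \<mu>"
  show "\<forall>v\<in>S. \<mu> * (v \<bullet> v) \<le> v \<bullet> (Q *v v)"
  proof
    fix v assume v: "v \<in> S"
    have "0 \<in> S" using S by (rule subspace_0)
    moreover have "(1/2) *\<^sub>R v \<in> S" using S v by (rule subspace_scale)
    \<comment> \<open>At the midpoint of \<open>v\<close> and \<open>0\<close> the linear and
      constant terms cancel, which leaves the claim scaled by \<open>1/8\<close>.\<close>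
    moreover have "quadratic_on S Q c d ((1/2) *\<^sub>R v + (1 - 1/2) *\<^sub>R 0) \<le>
        ereal (1/2) * quadratic_on S Q c d v + ereal (1 - 1/2) * quadratic_on S Q c d 0
        - ereal (\<mu> / 2 * (1/2) * (1 - 1/2) * (norm (v - 0))\<^sup>2)"
      using L[unfolded strong_convexity_ineq_def, rule_format, of "1/2" v 0] by simp
    ultimately have "v \<bullet> (Q *v v) / 8 + c \<bullet> v / 2 + d
        \<le> (v \<bullet> (Q *v v) / 2 + c \<bullet> v + d) / 2 + d / 2 - \<mu> * (norm v)\<^sup>2 / 8"
      using v by (simp add: quadratic_on_def quadratic_def matrix_vector_mult_scaleR)
    then show "\<mu> * (v \<bullet> v) \<le> v \<bullet> (Q *v v)"
      unfolding dot_square_norm by argo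
  qed
next
  assume R: "\<forall>v\<in>S. \<mu> * (v \<bullet> v) \<le> v \<bullet> (Q *v v)"
  show "strong_convexity_ineq (quadratic_on S Q c d) \<mu>"
    unfolding strong_convexity_ineq_def
  proof (intro allI ballI)
    fix x y :: "real^'n" and t :: real assume t: "t \<in> {0..1}"
    let ?f = "quadratic_on S Q c d" and ?z = "t *\<^sub>R x + (1 - t) *\<^sub>R y"
    show "?f ?z \<le> ereal t * ?f x + ereal (1 - t) * ?f y
        - ereal (\<mu> / 2 * t * (1 - t) * (norm (x - y))\<^sup>2)"
    \<comment> \<open>At the endpoints the product \<open>0 * \<infinity> = 0\<close> makes both
      sides agree even if a point lies outside \<open>S\<close>. For \<open>0 < t < 1\<close> such a
      point makes the right side infinite.\<close>
    proof (cases "t = 0 \<or> t = 1")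
      case True
      then show ?thesis
        by (auto simp: zero_ereal_def[symmetric] one_ereal_def[symmetric])
    next
      case False
      with t have t: "0 < t" "t < 1" by auto
      show ?thesis
      proof (cases "x \<in> S \<and> y \<in> S")
        case True
        then have z: "?z \<in> S" and xy: "x - y \<in> S"
          using S by (simp_all add: subspace_add subspace_scale subspace_diff)
        have "\<mu> * (norm (x - y))\<^sup>2 \<le> (x - y) \<bullet> (Q *v (x - y))"
          using R xy by (simp add: dot_square_norm)
        then have "(t * (1 - t)) * (\<mu> * (norm (x - y))\<^sup>2)
            \<le> (t * (1 - t)) * ((x - y) \<bullet> (Q *v (x - y)))"
          using t by (intro mult_left_mono) simp_all
        then have "quadratic Q c d ?z \<le> t * quadratic Q c d x + (1 - t) * quadratic Q c d y
            - \<mu> / 2 * t * (1 - t) * (norm (x - y))\<^sup>2"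
          unfolding quadratic_convex_comb by (simp add: mult_ac)
        then show ?thesis
          using True z by (simp only: quadratic_on_def if_True times_ereal.simps
              plus_ereal.simps ereal_minus ereal_less_eq)
      next
        case False
        then show ?thesis using t by (auto simp: quadratic_on_def)
      qed
    qed
  qed
qed

text \<open>Both sides of the bound are homogeneous of degree 2, so normalizing a nonzero
  \<open>v\<close> suffices.\<close>

lemma quadratic_form_sphere_iff:
  fixes S :: "(real^'n) set"
  assumes S: "subspace S"
  shows "(\<forall>v\<in>S. \<mu> * (v \<bullet> v) \<le> v \<bullet> (Q *v v)) \<longleftrightarrow> (\<forall>v\<in>S \<inter> sphere 0 1. \<mu> \<le> v \<bullet> (Q *v v))"
proof (intro iffI ballI)
  fix v assume "\<forall>v\<in>S. \<mu> * (v \<bullet> v) \<le> v \<bullet> (Q *v v)" "v \<in> S \<inter> sphere 0 1"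
  then show "\<mu> \<le> v \<bullet> (Q *v v)" by (auto simp: dot_square_norm)
next
  fix v assume R: "\<forall>v\<in>S \<inter> sphere 0 1. \<mu> \<le> v \<bullet> (Q *v v)" and v: "v \<in> S"
  show "\<mu> * (v \<bullet> v) \<le> v \<bullet> (Q *v v)"
  proof (cases "v = 0")
    case False
    have "v /\<^sub>R norm v \<in> S \<inter> sphere 0 1"
      using S v False by (simp add: subspace_scale)
    with R have "\<mu> \<le> (v /\<^sub>R norm v) \<bullet> (Q *v (v /\<^sub>R norm v))" by blast
    also have "\<dots> = (v \<bullet> (Q *v v)) / (v \<bullet> v)"
      by (simp add: matrix_vector_mult_scaleR divide_inverse dot_square_norm power2_eq_square)
    finally show ?thesis using False by (simp add: field_simps)
  qed simp
qed

lemma strong_convexity_ineq_quadratic_on_INF: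
  fixes S :: "(real^'n) set"
  assumes "subspace S"
  shows "strong_convexity_ineq (quadratic_on S Q c d) \<mu> \<longleftrightarrow>
    ereal \<mu> \<le> (INF v \<in> S \<inter> sphere 0 1. ereal (v \<bullet> (Q *v v)))"
  using assms
  by (simp add: strong_convexity_ineq_quadratic_on_iff quadratic_form_sphere_iff le_INF_iff)

text \<open>The unit sphere of \<open>S\<close> is compact, so the infimum is attained unless that
  sphere is empty. Emptiness means \<open>S = {0}\<close>, and the infimum in \<open>ereal\<close>
  is then \<open>\<infinity>\<close>.\<close>

lemma quadratic_form_INF_cases:
  fixes S :: "(real^'n) set" and Q :: "real^'n^'n"
  assumes S: "subspace S"
  defines "m \<equiv> INF v \<in> S \<inter> sphere 0 1. ereal (v \<bullet> (Q *v v))"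
  obtains "m = \<infinity>"
  | v where "v \<in> S \<inter> sphere 0 1" "m = ereal (v \<bullet> (Q *v v))"
proof (cases "S \<inter> sphere 0 1 = {}")
  case True
  then show ?thesis using that(1) by (simp add: m_def top_ereal_def)
next
  case False
  have "compact (S \<inter> sphere 0 1)"
    using S by (simp add: closed_subspace closed_Int_compact)
  moreover have "continuous_on (S \<inter> sphere 0 1) (\<lambda>v. v \<bullet> (Q *v v))"
    by (intro continuous_intros)
  ultimately have "\<exists>v\<in>S \<inter> sphere 0 1. \<forall>u\<in>S \<inter> sphere 0 1. v \<bullet> (Q *v v) \<le> u \<bullet> (Q *v u)"
    using False by (intro continuous_attains_inf)
  then obtain v where v: "v \<in> S \<inter> sphere 0 1"
    and min: "\<And>u. u \<in> S \<inter> sphere 0 1 \<Longrightarrow> v \<bullet> (Q *v v) \<le> u \<bullet> (Q *v u)"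
    by blast
  have "m = ereal (v \<bullet> (Q *v v))"
    unfolding m_def
    by (intro antisym INF_lower INF_greatest) (use v min in auto)
  with v show ?thesis by (rule that(2))
qed

lemma strong_convexity_index_quadratic_on:
  fixes S :: "(real^'n) set"
  assumes S: "subspace S"
  shows "is_strong_convexity_index (quadratic_on S Q c d)
    (INF v \<in> S \<inter> sphere 0 1. ereal (v \<bullet> (Q *v v)))"
  by (rule quadratic_form_INF_cases[OF S, of Q])
     (simp_all add: is_strong_convexity_index_def strong_convexity_ineq_quadratic_on_INF[OF S])

text \<open>Positivity on the unit sphere of \<open>S\<close> becomes a uniform \<open>\<mu>\<close>
  because the minimum is attained there. Semidefiniteness on \<open>S\<close> gives convexity of the
  epigraph.\<close>

lemma strongly_convex_quadratic_on_iff: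
  fixes S :: "(real^'n) set" and Q :: "real^'n^'n"
  assumes S: "subspace S" and psd: "\<And>v. v \<in> S \<Longrightarrow> 0 \<le> v \<bullet> (Q *v v)"
  shows "strongly_convex (quadratic_on S Q c d) \<longleftrightarrow> (\<forall>v\<in>S. v \<bullet> (Q *v v) = 0 \<longrightarrow> v = 0)"
proof
  let ?f = "quadratic_on S Q c d"
  assume "strongly_convex ?f"
  then obtain \<mu> where \<mu>: "\<mu> > 0" "\<forall>v\<in>S. \<mu> * (v \<bullet> v) \<le> v \<bullet> (Q *v v)"
    unfolding strongly_convex_def strong_convexity_ineq_quadratic_on_iff[OF S] by blast
  show "\<forall>v\<in>S. v \<bullet> (Q *v v) = 0 \<longrightarrow> v = 0"
  proof (intro ballI impI)
    fix v assume "v \<in> S" "v \<bullet> (Q *v v) = 0"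
    with \<mu>(2) have "\<mu> * (v \<bullet> v) \<le> 0" by fastforce
    with \<mu>(1) have "v \<bullet> v \<le> 0" by (simp add: mult_le_0_iff)
    then show "v = 0" by (metis inner_gt_zero_iff not_le)
  qed
next
  let ?f = "quadratic_on S Q c d" and ?g = "quadratic Q c d"
  assume pd: "\<forall>v\<in>S. v \<bullet> (Q *v v) = 0 \<longrightarrow> v = 0"
  have "proper_fun ?f"
    using subspace_0[OF S] unfolding proper_fun_def quadratic_on_def by force
  moreover have epi: "ereal_epigraph ?f = (S \<times> UNIV) \<inter> {p. ?g (fst p) \<le> snd p}"
    by (auto simp: ereal_epigraph_def quadratic_on_def split: if_splits)
  then have "closed_fun ?f"
    unfolding closed_fun_def epi quadratic_def
    by (intro closed_Int closed_Times closed_subspace[OF S] closed_UNIV closed_Collect_le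
        continuous_intros linear_continuous_on_compose[OF _ matrix_vector_mul_linear])
  moreover have "convex_fun ?f"
    unfolding convex_fun_def epi
  proof (rule convexI)
    fix p q :: "(real^'n) \<times> real" and u v :: real
    assume p: "p \<in> (S \<times> UNIV) \<inter> {p. ?g (fst p) \<le> snd p}"
      and q: "q \<in> (S \<times> UNIV) \<inter> {p. ?g (fst p) \<le> snd p}"
      and uv: "0 \<le> u" "0 \<le> v" "u + v = 1"
    have v: "v = 1 - u" using uv by simp
    obtain x r y s where pq: "p = (x, r)" "q = (y, s)" by (cases p, cases q)
    have "0 \<le> u * (1 - u) * ((x - y) \<bullet> (Q *v (x - y)))"
      using uv p q pq S by (intro mult_nonneg_nonneg psd) (auto simp: subspace_diff)
    moreover have "u * ?g x \<le> u * r" "(1 - u) * ?g y \<le> (1 - u) * s"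
      using p q pq uv by (auto intro!: mult_left_mono)
    ultimately have "?g (u *\<^sub>R x + (1 - u) *\<^sub>R y) \<le> u * r + (1 - u) * s"
      unfolding quadratic_convex_comb by linarith
    then show "u *\<^sub>R p + v *\<^sub>R q \<in> (S \<times> UNIV) \<inter> {p. ?g (fst p) \<le> snd p}"
      using p q pq S by (simp add: v subspace_add subspace_scale)
  qed
  moreover have "\<exists>\<mu>>0. strong_convexity_ineq ?f \<mu>"
  proof (rule quadratic_form_INF_cases[OF S, of Q])
    \<comment> \<open>Here \<open>S\<close> is trivial and every \<open>\<mu>\<close> is admissible;
      \<open>1\<close> is an arbitrary choice.\<close>
    assume "(INF v \<in> S \<inter> sphere 0 1. ereal (v \<bullet> (Q *v v))) = \<infinity>"
    then show ?thesis
      unfolding strong_convexity_ineq_quadratic_on_INF[OF S] by (auto intro: exI[of _ 1])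
  next
    fix v assume v: "v \<in> S \<inter> sphere 0 1"
      and m: "(INF v \<in> S \<inter> sphere 0 1. ereal (v \<bullet> (Q *v v))) = ereal (v \<bullet> (Q *v v))"
    have "v \<noteq> 0" using v by auto
    then have "0 < v \<bullet> (Q *v v)"
      using v pd psd[of v] by (auto simp: order_le_less)
    then show ?thesis
      unfolding strong_convexity_ineq_quadratic_on_INF[OF S] m by auto
  qed
  ultimately show "strongly_convex ?f" by (simp add: strongly_convex_def)
qed

section \<open>The objective\<close>

lemma subspace_range_space: "subspace (range_space W)"
  unfolding range_space_def
  by (rule linear_subspace_image[OF matrix_vector_mul_linear subspace_UNIV])

lemma gram_plus_form:
  fixes A :: "real^'n^'m"
  shows "v \<bullet> ((transpose A ** A + lam *\<^sub>R M) *v v) = (norm (A *v v))\<^sup>2 + lam * (v \<bullet> (M *v v))"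
  using inner_matrix_vector_mult[of v "transpose A" "A *v v"]
  by (simp add: matrix_vector_mult_add_rdistrib inner_add_right dot_square_norm
      flip: matrix_vector_mul_assoc scaleR_matrix_vector_assoc)

text \<open>Expanding the square leaves \<open>b\<close> only in the linear and constant terms.
  Positivity of \<open>lam\<close> keeps \<open>lam * \<infinity> = \<infinity>\<close> outside the
  range of \<open>W\<close>.\<close>

lemma objective_eq_quadratic_on:
  fixes A :: "real^'n^'m"
  assumes "lam > 0"
  shows "objective A b W lam = quadratic_on (range_space W)
    (transpose A ** A + lam *\<^sub>R (pseudoinverse W ** (mat 1 - W)))
    (- (transpose A *v b)) (1/2 * (norm b)\<^sup>2)"
proof
  fix x
  have "loss A b x = 1/2 * (norm (A *v x))\<^sup>2 + (- (transpose A *v b)) \<bullet> x + 1/2 * (norm b)\<^sup>2"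
    using inner_matrix_vector_mult[of b A x]
    by (simp add: loss_def power2_norm_eq_inner inner_diff_left inner_diff_right inner_commute
        algebra_simps)
  then show "objective A b W lam x = quadratic_on (range_space W)
      (transpose A ** A + lam *\<^sub>R (pseudoinverse W ** (mat 1 - W)))
      (- (transpose A *v b)) (1/2 * (norm b)\<^sup>2) x"
    using assms
    by (simp add: objective_def regularizer_def convex_indicator_def quadratic_on_def quadratic_def
        gram_plus_form add_divide_distrib add_ac)
qed

theorem theorem3p2:
  fixes A :: "real^'n^'m" and b :: "real^'m" and W :: "real^'n^'n" and lam :: real
  assumes "transpose W = W" and "spectrum W \<subseteq> {0..1}" and "lam > 0"
  shows "let f = objective A b W lam;
             Q = transpose A ** A + lam *\<^sub>R (pseudoinverse W ** (mat 1 - W))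
         in (strongly_convex f \<longleftrightarrow> null_space A \<inter> fix_space W = {0}) \<and>
            is_strong_convexity_index f
              (INF v \<in> range_space W \<inter> sphere 0 1. ereal (v \<bullet> (Q *v v)))"
proof -
  let ?M = "pseudoinverse W ** (mat 1 - W)"
  let ?Q = "transpose A ** A + lam *\<^sub>R ?M"
  have nonneg: "0 \<le> lam * (v \<bullet> (?M *v v))" if "v \<in> range_space W" for v
    using regularizer_form_nonneg[OF assms(1,2) that] assms(3) by simp
  have psd: "0 \<le> v \<bullet> (?Q *v v)" if "v \<in> range_space W" for v
    using nonneg[OF that] by (simp add: gram_plus_form)
  \<comment> \<open>Both summands of the form are nonnegative, so their sum vanishes only if each
    does: one gives \<open>A *v v = 0\<close>, the other \<open>W *v v = v\<close>.\<close>
  have zero: "v \<bullet> (?Q *v v) = 0 \<longleftrightarrow> v \<in> null_space A \<inter> fix_space W"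
    if "v \<in> range_space W" for v
    using nonneg[OF that] regularizer_form_eq_0_iff[OF assms(1,2) that] assms(3)
    by (simp add: gram_plus_form add_nonneg_eq_0_iff null_space_def)
  \<comment> \<open>A fixed vector is its own image under \<open>W\<close>, so restricting
    \<open>zero\<close> to the range loses no element of the intersection.\<close>
  have "fix_space W \<subseteq> range_space W"
    unfolding fix_space_def range_space_def by (auto intro: range_eqI[OF sym])
  moreover have "0 \<in> null_space A \<inter> fix_space W"
    by (simp add: null_space_def fix_space_def)
  ultimately have "(\<forall>v\<in>range_space W. v \<bullet> (?Q *v v) = 0 \<longrightarrow> v = 0) \<longleftrightarrow>
      null_space A \<inter> fix_space W = {0}"
    using zero by blast
  then have "strongly_convex (quadratic_on (range_space W) ?Q c d) \<longleftrightarrow>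
      null_space A \<inter> fix_space W = {0}" for c d
    using strongly_convex_quadratic_on_iff[OF subspace_range_space psd] by blast
  then show ?thesis
    unfolding Let_def objective_eq_quadratic_on[OF assms(3)]
    by (intro conjI strong_convexity_index_quadratic_on subspace_range_space)
qed

end
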